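(* Let $f:\mathbb{N}\to\mathbb{N}$ be a function. The following conditions are equivalent. (i) Every lattice of regular subsets of $\mathbb{N}$ closed under decrement is closed under $f^{-1}$. (ii) For every finite subset $L$ of $\mathbb{N}$, the lattice $\mathcal{L}(L)$ is closed under $f^{-1}$. (iii) For every arithmetic progression $L=q+r\mathbb{N}$, with $q,r\in\mathbb{N}$ and $r>0$, the lattice $\mathcal{L}(L)$ is closed under $f^{-1}$. (iv) The map $f$ is non decreasing and satisfies $f(a)\geq a$ and $f(a)-f(b)\equiv 0\pmod{(a-b)}$ for all $a,b\in\mathbb{N}$.
   Context: $\mathbb{N}=\{0,1,2,\ldots\}$. A function $f:\mathbb{N}\to\mathbb{N}$ is non decreasing if $a\leq b$ implies $f(a)\leq f(b)$. A lattice over a set $X$ is any non empty family of subsets of $X$ closed under (binary) union and intersection. For $L\subseteq\mathbb{N}$ and $i\in\mathbb{N}$, the $i$-decrement of $L$ is $L-i=\{x\in\mathbb{N}\mid x+i\in L\}$; a family $\mathcal{L}$ of subsets of $\mathbb{N}$ is closed under decrement if $L\in\mathcal{L}$ implies $L-1\in\mathcal{L}$. It is closed under $f^{-1}$ if $L\in\mathcal{L}$ implies $f^{-1}(L)=\{x\in\mathbb{N}\mid f(x)\in L\}\in\mathcal{L}$. A subset of $\mathbb{N}$ is regular if it is recognized by a finite automaton in unary notation; equivalently, if it is the union of a finite set with finitely many arithmetic progressions $a+r\mathbb{N}$ ($a,r\in\mathbb{N}$, $r\geq1$). For $L\subseteq\mathbb{N}$, $\mathcal{L}(L)$ denotes the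 smallest lattice of subsets of $\mathbb{N}$ containing $L$ as a member and closed under decrement; equivalently, the family of all sets of the form $\bigcup_{j\in J}\bigcap_{i\in I_j}(L-i)$ where $J$ and the $I_j$'s are finite non empty subsets of $\mathbb{N}$. *)

theory Defs
  imports "HOL-Number_Theory.Cong"
begin

definition set_lattice :: "'a set set \<Rightarrow> bool" where
  "set_lattice \<L> \<longleftrightarrow> \<L> \<noteq> {} \<and> (\<forall>A\<in>\<L>. \<forall>B\<in>\<L>. A \<union> B \<in> \<L> \<and> A \<inter> B \<in> \<L>)"

definition decrement :: "nat set \<Rightarrow> nat \<Rightarrow> nat set" where
  "decrement L i = {x. x + i \<in> L}"

definition closed_under_decrement :: "nat set set \<Rightarrow> bool" where
  "closed_under_decrement \<L> \<longleftrightarrow> (\<forall>L\<in>\<L>. decrement L 1 \<in> \<L>)"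

definition closed_under_preimage :: "(nat \<Rightarrow> nat) \<Rightarrow> nat set set \<Rightarrow> bool" where
  "closed_under_preimage f \<L> \<longleftrightarrow> (\<forall>L\<in>\<L>. f -` L \<in> \<L>)"

definition arith_prog :: "nat \<Rightarrow> nat \<Rightarrow> nat set" where
  "arith_prog q r = {q + r * n | n. True}"

(* A finite deterministic automaton over a one-letter alphabet: the transition function is a
   self-map d of the finite state set Q, and reading the unary notation of n applies it n times.
   Taking natural numbers as states is no restriction, since Q is finite. *)
definition regular_nat_set :: "nat set \<Rightarrow> bool" where
  "regular_nat_set L \<longleftrightarrow>
    (\<exists>(Q::nat set) d q0 F. finite Q \<and> q0 \<in> Q \<and> d ` Q \<subseteq> Q \<and> F \<subseteq> Q \<and>
       L = {n. (d ^^ n) q0 \<in> F})"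

definition generated_lattice :: "nat set \<Rightarrow> nat set set" where
  "generated_lattice L = \<Inter>{\<L>. set_lattice \<L> \<and> closed_under_decrement \<L> \<and> L \<in> \<L>}"

lemma mem_generated_lattice: "L \<in> generated_lattice L"
  by (auto simp: generated_lattice_def)

lemma set_lattice_generated_lattice: "set_lattice (generated_lattice L)"
  using mem_generated_lattice[of L] unfolding set_lattice_def
  by (auto simp: generated_lattice_def set_lattice_def)

lemma closed_under_decrement_generated_lattice:
  "closed_under_decrement (generated_lattice L)"
  by (auto simp: generated_lattice_def closed_under_decrement_def)

lemma generated_lattice_least:
  "set_lattice \<L> \<Longrightarrow> closed_under_decrement \<L> \<Longrightarrow> L \<in> \<L> \<Longrightarrow> generated_lattice L \<subseteq> \<L>"
  by (auto simp: generated_lattice_def)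

lemma regular_nat_set_imp_eventually_periodic:
  assumes "regular_nat_set L"
  obtains N p where "p > 0" "\<And>n. n \<ge> N \<Longrightarrow> n + p \<in> L \<longleftrightarrow> n \<in> L"
proof -
  obtain Q :: "nat set" and d q0 F where fin: "finite Q" and q0: "q0 \<in> Q" and d: "d ` Q \<subseteq> Q"
    and L: "L = {n. (d ^^ n) q0 \<in> F}"
    using assms unfolding regular_nat_set_def by blast
  have st: "(d ^^ n) q0 \<in> Q" for n
    using q0 d by (induction n) auto
  have "\<not> inj (\<lambda>n. (d ^^ n) q0)"
    using finite_subset[OF _ fin, of "range (\<lambda>n. (d ^^ n) q0)"] st
    by (auto dest: finite_imageD)
  then obtain i j where ij: "i < j" "(d ^^ i) q0 = (d ^^ j) q0"
    unfolding inj_def by (metis linorder_neqE_nat)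
  have "n + (j - i) \<in> L \<longleftrightarrow> n \<in> L" if "n \<ge> i" for n
  proof -
    have e: "n + (j - i) = (n - i) + j" "n = (n - i) + i"
      using that ij by auto
    have "(d ^^ (n + (j - i))) q0 = (d ^^ (n - i)) ((d ^^ j) q0)"
      by (subst e(1)) (simp only: funpow_add o_apply)
    also have "\<dots> = (d ^^ ((n - i) + i)) q0"
      by (simp only: funpow_add o_apply ij(2))
    also have "\<dots> = (d ^^ n) q0"
      using e(2) by simp
    finally show ?thesis
      by (simp add: L)
  qed
  with ij(1) show ?thesis
    by (intro that[of "j - i" i]) auto
qed

lemma eventually_periodic_mult:
  assumes per: "\<And>n::nat. n \<ge> N \<Longrightarrow> n + p \<in> L \<longleftrightarrow> n \<in> L" and "n \<ge> N"
  shows "n + k * p \<in> L \<longleftrightarrow> n \<in> L"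
proof (induction k)
  case (Suc k)
  have e: "n + Suc k * p = (n + k * p) + p" by simp
  show ?case unfolding e using per[OF trans_le_add1[OF \<open>n \<ge> N\<close>], of "k * p"] Suc by blast
qed simp

lemma eventually_periodic_imp_regular_nat_set:
  assumes "p > 0" and per: "\<And>n. n \<ge> N \<Longrightarrow> n + p \<in> L \<longleftrightarrow> n \<in> L"
  shows "regular_nat_set L"
proof -
  define d where "d = (\<lambda>s. if Suc s = N + p then N else Suc s)"
  have inv: "(d ^^ n) 0 < N + p \<and> ((d ^^ n) 0 \<in> L \<longleftrightarrow> n \<in> L) \<and>
      (\<exists>k. n = (d ^^ n) 0 + k * p \<and> (k > 0 \<longrightarrow> (d ^^ n) 0 \<ge> N))" for n
  proof -
    have run: "(d ^^ n) 0 < N + p \<and>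
      (\<exists>k. n = (d ^^ n) 0 + k * p \<and> (k > 0 \<longrightarrow> (d ^^ n) 0 \<ge> N))"
    proof (induction n)
      case 0
      then show ?case using \<open>p > 0\<close> by auto
    next
      case (Suc n)
      then obtain k where k: "(d ^^ n) 0 < N + p" "n = (d ^^ n) 0 + k * p"
        "k > 0 \<longrightarrow> (d ^^ n) 0 \<ge> N" by blast
      show ?case
      proof (cases "Suc ((d ^^ n) 0) = N + p")
        case True
        then have *: "Suc n = N + Suc k * p" using k by simp
        have **: "(d ^^ Suc n) 0 = N" using True by (simp add: d_def)
        show ?thesis unfolding ** using * \<open>p > 0\<close> by (intro conjI exI[of _ "Suc k"]) auto
      next
        case False
        then have **: "(d ^^ Suc n) 0 = Suc ((d ^^ n) 0)" by (simp add: d_def)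
        have "Suc n = Suc ((d ^^ n) 0) + k * p" using k(2) by simp
        then show ?thesis unfolding ** using k False
          by (metis Suc_lessI le_SucI)
      qed
    qed
    then obtain k where k: "n = (d ^^ n) 0 + k * p" "k > 0 \<longrightarrow> (d ^^ n) 0 \<ge> N" by blast
    have "m \<ge> N \<Longrightarrow> m + k * p \<in> L \<longleftrightarrow> m \<in> L" for m
      using eventually_periodic_mult[of N p L] per by blast
    from this[of "(d ^^ n) 0"] k have "(d ^^ n) 0 \<in> L \<longleftrightarrow> n \<in> L"
      by (cases "k = 0") auto
    with run show ?thesis by blast
  qed
  show ?thesis
    unfolding regular_nat_set_def
  proof (intro exI conjI)
    show "finite {..<N + p}" by simp
    show "0 \<in> {..<N + p}" using \<open>p > 0\<close> by simp
    show "d ` {..<N + p} \<subseteq> {..<N + p}" using \<open>p > 0\<close> by (auto simp: d_def)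
    show "L \<inter> {..<N + p} \<subseteq> {..<N + p}" by simp
    show "L = {n. (d ^^ n) 0 \<in> L \<inter> {..<N + p}}" using inv by auto
  qed
qed

lemma finite_Un_arith_progs_eventually_periodic:
  assumes "finite P" "\<forall>(a, r)\<in>P. r > 0"
  shows "\<exists>N p. p > 0 \<and> (\<forall>n\<ge>N. n + p \<in> (\<Union>(a, r)\<in>P. arith_prog a r) \<longleftrightarrow>
           n \<in> (\<Union>(a, r)\<in>P. arith_prog a r))"
  using assms
proof (induction P rule: finite_induct)
  case empty
  then show ?case by auto
next
  case (insert x P)
  obtain a r where x: "x = (a, r)" by (cases x)
  have r: "r > 0" using insert x by auto
  let ?U = "\<Union>(a, r)\<in>P. arith_prog a r"
  obtain N p where N: "p > 0" "\<And>n. n \<ge> N \<Longrightarrow> n + p \<in> ?U \<longleftrightarrow> n \<in> ?U"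
    using insert by auto
  have U: "n \<ge> N \<Longrightarrow> n + k * p \<in> ?U \<longleftrightarrow> n \<in> ?U" for n k
    using eventually_periodic_mult[of N p ?U] N(2) by blast
  have A: "n + r * p \<in> arith_prog a r \<longleftrightarrow> n \<in> arith_prog a r" if "n \<ge> a" for n
  proof
    assume "n + r * p \<in> arith_prog a r"
    then obtain m where m: "n + r * p = a + r * m" by (auto simp: arith_prog_def)
    have "r * p \<le> r * m" using m that by linarith
    then have "n = a + r * (m - p)"
      using m that by (simp add: diff_mult_distrib2)
    then show "n \<in> arith_prog a r" by (auto simp: arith_prog_def)
  next
    assume "n \<in> arith_prog a r"
    then obtain m where "n = a + r * m" by (auto simp: arith_prog_def)
    then have "n + r * p = a + r * (m + p)" by (simp add: algebra_simps)
    then show "n + r * p \<in> arith_prog a r" unfolding arith_prog_def by blast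
  qed
  show ?case
    using r N(1) A U[of _ r] by (intro exI[of _ "max a N"] exI[of _ "r * p"]) (simp add: x)
qed

lemma regular_nat_set_iff_arith_progs:
  "regular_nat_set L \<longleftrightarrow>
    (\<exists>A P. finite A \<and> finite P \<and> (\<forall>(a, r)\<in>P. r \<ge> 1) \<and>
       L = A \<union> (\<Union>(a, r)\<in>P. arith_prog a r))"
  (is "_ \<longleftrightarrow> ?R")
proof
  assume "regular_nat_set L"
  then obtain N p where p: "p > 0" and per: "\<And>n. n \<ge> N \<Longrightarrow> n + p \<in> L \<longleftrightarrow> n \<in> L"
    using regular_nat_set_imp_eventually_periodic by blast
  have step: "n \<ge> N \<Longrightarrow> n + p * k \<in> L \<longleftrightarrow> n \<in> L" for n k
    using eventually_periodic_mult[of N p L] per by (metis mult.commute)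
  define P where "P = (L \<inter> {N..<N + p}) \<times> {p}"
  have "n \<in> (\<Union>(a, r)\<in>P. arith_prog a r)" if n: "n \<in> L" "n \<ge> N" for n
  proof -
    define a where "a = N + (n - N) mod p"
    have e: "n = a + p * ((n - N) div p)" using n by (simp add: a_def)
    have "a \<in> L" using step[of a "(n - N) div p"] n(1) e by (simp add: a_def)
    then have "(a, p) \<in> P" using p by (auto simp: P_def a_def)
    moreover have "n \<in> arith_prog a p" using e unfolding arith_prog_def by blast
    ultimately show ?thesis by blast
  qed
  then have "L = (L \<inter> {..<N}) \<union> (\<Union>(a, r)\<in>P. arith_prog a r)"
    using step by (fastforce simp: P_def arith_prog_def not_less)
  moreover have "finite (L \<inter> {..<N})" "finite P" "\<forall>(a, r)\<in>P. r \<ge> 1"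
    using p by (auto simp: P_def)
  ultimately show ?R by blast
next
  assume ?R
  then obtain A P where AP: "finite A" "finite P" "\<forall>(a, r)\<in>P. r \<ge> 1"
    "L = A \<union> (\<Union>(a, r)\<in>P. arith_prog a r)" by blast
  obtain N p where N: "p > 0" "\<forall>n\<ge>N. n + p \<in> (\<Union>(a, r)\<in>P. arith_prog a r) \<longleftrightarrow>
      n \<in> (\<Union>(a, r)\<in>P. arith_prog a r)"
    using finite_Un_arith_progs_eventually_periodic[of P] AP by (auto simp: Suc_le_eq)
  obtain M where M: "\<forall>x\<in>A. x < M"
    using AP(1) finite_nat_set_iff_bounded by blast
  show "regular_nat_set L"
    by (rule eventually_periodic_imp_regular_nat_set[OF N(1), of "max N M"]) (use N(2) M AP(4) in fastforce)
qed

end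

theory Submission
  imports Defs
begin

text \<open>
  Write \<open>u \<sqsubseteq> v\<close> if \<open>u + t \<in> L\<close> implies \<open>v + t \<in> L\<close> for all \<open>t\<close>.  Every member of the lattice
  generated by \<open>L\<close> is upward closed for \<open>\<sqsubseteq>\<close>; applied to \<open>f -` L\<close> for suitable segments and
  (truncated) arithmetic progressions \<open>L\<close>, this forces the arithmetic conditions on \<open>f\<close>.
  Conversely, a regular \<open>L\<close> has finitely many decrements, so a nonempty \<open>\<sqsubseteq>\<close>-upward closed set
  covered by them is the finite union, over its points, of the intersections of the decrements
  containing the point.  The arithmetic conditions make \<open>f -` L\<close> such a set, unless it is empty:
  it is covered since \<open>f a \<ge> a\<close>, and for \<open>a \<sqsubseteq> b\<close> one walks from \<open>f a\<close> to \<open>f b\<close> inside \<open>L\<close> in steps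
  of length \<open>\<bar>b - a\<bar>\<close>.
\<close>

section \<open>Lattice operations over finite families and decrements\<close>

lemma set_lattice_Union:
  assumes "set_lattice \<L>" "finite F" "F \<noteq> {}" "F \<subseteq> \<L>"
  shows "\<Union>F \<in> \<L>"
  using assms(2-) by (induction rule: finite_ne_induct) (use assms(1) in \<open>auto simp: set_lattice_def\<close>)

lemma set_lattice_Inter:
  assumes "set_lattice \<L>" "finite F" "F \<noteq> {}" "F \<subseteq> \<L>"
  shows "\<Inter>F \<in> \<L>"
  using assms(2-) by (induction rule: finite_ne_induct) (use assms(1) in \<open>auto simp: set_lattice_def\<close>)

lemma decrement_mem:
  assumes "closed_under_decrement \<L>" "L \<in> \<L>"
  shows "decrement L t \<in> \<L>"
proof (induction t)
  case 0
  show ?case using assms(2) by (simp add: decrement_def)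
next
  case (Suc t)
  have "decrement L (Suc t) = decrement (decrement L t) 1"
    by (simp add: decrement_def)
  with Suc assms(1) show ?case by (simp add: closed_under_decrement_def)
qed

text \<open>Once \<open>t\<close> is past the preperiod, lowering it by the period leaves the
  decrement unchanged, so only the values \<open>t < N + p\<close> matter.\<close>

lemma finite_decrements:
  assumes "regular_nat_set L"
  shows "finite (range (decrement L))"
proof -
  obtain N p where p: "p > 0" and per: "\<And>n. n \<ge> N \<Longrightarrow> n + p \<in> L \<longleftrightarrow> n \<in> L"
    using regular_nat_set_imp_eventually_periodic[OF assms] by blast
  have "decrement L t \<in> decrement L ` {..<N + p}" for t
  proof (induction t rule: less_induct)
    case (less t)
    show ?case
    proof (cases "t < N + p")
      case False
      have "x + t \<in> L \<longleftrightarrow> x + (t - p) \<in> L" for x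
        using per[of "x + (t - p)"] False by (simp add: add.assoc)
      then have "decrement L t = decrement L (t - p)"
        by (simp add: decrement_def)
      then show ?thesis using less[of "t - p"] False p by simp
    qed simp
  qed
  then have "range (decrement L) \<subseteq> decrement L ` {..<N + p}" by blast
  then show ?thesis by (rule finite_subset) simp
qed

lemma mem_lattice_if_upward_closed:
  assumes \<L>: "set_lattice \<L>" "closed_under_decrement \<L>" "L \<in> \<L>"
    and L: "regular_nat_set L"
    and covered: "\<And>a. a \<in> X \<Longrightarrow> \<exists>t. a + t \<in> L"
    and "X \<noteq> {}"
    and upward: "\<And>a b. a \<in> X \<Longrightarrow> (\<And>t. a + t \<in> L \<Longrightarrow> b + t \<in> L) \<Longrightarrow> b \<in> X"
  shows "X \<in> \<L>"
proof -
  \<comment> \<open>\<open>\<Inter>(D a)\<close> consists of all \<open>b\<close> such that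
    \<open>a + t \<in> L\<close> implies \<open>b + t \<in> L\<close> for every \<open>t\<close>:
    the principal upper set of \<open>a\<close>.\<close>
  define D where "D a = {M \<in> range (decrement L). a \<in> M}" for a
  have D: "D a \<subseteq> range (decrement L)" for a by (auto simp: D_def)
  note fin = finite_decrements[OF L]
  have "\<Inter>(D a) \<in> \<L>" if "a \<in> X" for a
  proof (rule set_lattice_Inter[OF \<L>(1)])
    show "finite (D a)" by (rule finite_subset[OF D fin])
    \<comment> \<open>The lattice provides intersections of nonempty families only; this is where
      \<open>covered\<close> enters.\<close>
    show "D a \<noteq> {}" using covered[OF that] by (auto simp: D_def decrement_def)
    show "D a \<subseteq> \<L>" using D decrement_mem[OF \<L>(2,3)] by blast
  qed
  \<comment> \<open>\<open>X\<close> may be infinite, but each \<open>D a\<close> is one of the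
    finitely many subsets of a finite set.\<close>
  moreover have "finite ((\<lambda>a. \<Inter>(D a)) ` X)"
  proof -
    have "(\<lambda>a. \<Inter>(D a)) ` X \<subseteq> Inter ` Pow (range (decrement L))"
      using D by (intro image_subsetI imageI PowI)
    then show ?thesis by (rule finite_subset) (use fin in simp)
  qed
  ultimately have "(\<Union>a\<in>X. \<Inter>(D a)) \<in> \<L>"
    using \<open>X \<noteq> {}\<close> by (intro set_lattice_Union[OF \<L>(1)]) auto
  moreover have "(\<Union>a\<in>X. \<Inter>(D a)) = X"
  proof
    show "(\<Union>a\<in>X. \<Inter>(D a)) \<subseteq> X"
    proof
      fix b assume "b \<in> (\<Union>a\<in>X. \<Inter>(D a))"
      then obtain a where "a \<in> X" and "b \<in> \<Inter>(D a)" by blast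
      then show "b \<in> X"
        by (intro upward[of a b]) (auto simp: D_def decrement_def)
    qed
    show "X \<subseteq> (\<Union>a\<in>X. \<Inter>(D a))" unfolding D_def by blast
  qed
  ultimately show ?thesis by simp
qed

text \<open>Serves the case of an empty preimage, where the empty set itself must be found in the
  lattice.\<close>

lemma Inter_decrements_mem:
  assumes "set_lattice \<L>" "closed_under_decrement \<L>" "L \<in> \<L>" "regular_nat_set L"
  shows "(\<Inter>t. decrement L t) \<in> \<L>"
  using decrement_mem[OF assms(2,3)] finite_decrements[OF assms(4)]
  by (intro set_lattice_Inter[OF assms(1)]) auto

section \<open>From the arithmetic conditions to closure under preimages\<close>

lemma preimage_upward_closed:
  fixes f :: "nat \<Rightarrow> nat"
  assumes "mono f" and ge: "\<And>a. f a \<ge> a"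
    and cong: "\<And>a b. [int (f a) - int (f b) = 0] (mod (int a - int b))"
    and fa: "f a \<in> L" and ab: "\<And>t. a + t \<in> L \<Longrightarrow> b + t \<in> L"
  shows "f b \<in> L"
proof (cases a b rule: linorder_cases)
  case equal
  then show ?thesis using fa by simp
next
  case less
  have le: "f a \<le> f b" using less \<open>mono f\<close> by (simp add: monoD)
  have "int (b - a) dvd int (f b - f a)"
    using cong[of b a] less le by (simp add: cong_0_iff of_nat_diff)
  then obtain k where "f b - f a = (b - a) * k" by auto
  then have k: "f b = f a + k * (b - a)" using le by (simp add: mult.commute)
  \<comment> \<open>Every point of the walk is at least \<open>f a \<ge> a\<close>, hence of the
    form \<open>a + t\<close>; then \<open>b + t\<close> is the next point.\<close>
  have "f a + j * (b - a) \<in> L" for j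
  proof (induction j)
    case (Suc j)
    have "a + (f a + j * (b - a) - a) \<in> L" using Suc ge[of a] by simp
    then have "b + (f a + j * (b - a) - a) \<in> L" by (rule ab)
    moreover have "b + (f a + j * (b - a) - a) = f a + Suc j * (b - a)"
      using ge[of a] less by simp
    ultimately show ?case by metis
  qed (use fa in simp)
  then show ?thesis by (simp only: k)
next
  case greater
  have le: "f b \<le> f a" using greater \<open>mono f\<close> by (simp add: monoD)
  have "int (a - b) dvd int (f a - f b)"
    using cong[of a b] greater le by (simp add: cong_0_iff of_nat_diff)
  then obtain k where "f a - f b = (a - b) * k" by auto
  then have k: "f a = f b + k * (a - b)" using le by (simp add: mult.commute)
  \<comment> \<open>Here the walk goes down: \<open>j\<close> decreases from \<open>k\<close>, where
    the point is \<open>f a\<close>, to \<open>0\<close>, where it is \<open>f b\<close>.\<close>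
  have "f b + j * (a - b) \<in> L" if "j \<le> k" for j
    using that
  proof (induction rule: inc_induct)
    case base
    then show ?case using fa by (simp only: k)
  next
    case (step j)
    \<comment> \<open>The point reached before each step is at least \<open>a\<close>, because \<open>f b \<ge> b\<close>.\<close>
    have "a + (f b + j * (a - b) - b) = f b + Suc j * (a - b)"
      using ge[of b] greater by simp
    then have "b + (f b + j * (a - b) - b) \<in> L"
      using step.IH by (intro ab) metis
    then show ?case using ge[of b] by simp
  qed
  from this[of 0] show ?thesis by simp
qed

lemma preimage_mem_lattice:
  fixes f :: "nat \<Rightarrow> nat"
  assumes f: "mono f" "\<And>a. f a \<ge> a"
      "\<And>a b. [int (f a) - int (f b) = 0] (mod (int a - int b))"
    and \<L>: "set_lattice \<L>" "closed_under_decrement \<L>" "L \<in> \<L>"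
    and L: "regular_nat_set L"
  shows "f -` L \<in> \<L>"
proof (cases "f -` L = {}")
  case True
  \<comment> \<open>A common element \<open>b\<close> would put everything from \<open>b\<close> on
    into \<open>L\<close>, including \<open>f b\<close>.\<close>
  have "(\<Inter>t. decrement L t) = {}"
  proof (rule ccontr)
    assume "(\<Inter>t. decrement L t) \<noteq> {}"
    then obtain b where "b + t \<in> L" for t by (auto simp: decrement_def)
    from this[of "f b - b"] have "f b \<in> L" using f(2)[of b] by simp
    with True show False by blast
  qed
  with True Inter_decrements_mem[OF \<L> L] show ?thesis by simp
next
  case False
  show ?thesis
  proof (rule mem_lattice_if_upward_closed[OF \<L> L _ False])
    show "\<exists>t. a + t \<in> L" if "a \<in> f -` L" for a
      using that f(2)[of a] by (intro exI[of _ "f a - a"]) simp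
  next
    show "b \<in> f -` L" if "a \<in> f -` L" "\<And>t. a + t \<in> L \<Longrightarrow> b + t \<in> L" for a b
      using preimage_upward_closed[OF f, of a L b] that by simp
  qed
qed

section \<open>Invariants of the generated lattice, and regular test sets\<close>

lemma generated_lattice_regular:
  assumes "regular_nat_set L" "X \<in> generated_lattice L"
  shows "regular_nat_set X"
proof -
  obtain N p where p: "p > 0" and per: "\<And>n. n \<ge> N \<Longrightarrow> n + p \<in> L \<longleftrightarrow> n \<in> L"
    using regular_nat_set_imp_eventually_periodic[OF assms(1)] by blast
  \<comment> \<open>The threshold \<open>N\<close> and period \<open>p\<close> of \<open>L\<close>
    serve for all members at once.\<close>
  let ?P = "{X. \<forall>n\<ge>N. n + p \<in> X \<longleftrightarrow> n \<in> X}"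
  have "generated_lattice L \<subseteq> ?P"
  proof (rule generated_lattice_least)
    show "set_lattice ?P" by (auto simp: set_lattice_def)
    show "closed_under_decrement ?P"
      unfolding closed_under_decrement_def
    proof (intro ballI CollectI allI impI)
      fix X n assume "X \<in> ?P" "N \<le> n"
      then have "Suc n + p \<in> X \<longleftrightarrow> Suc n \<in> X" using le_SucI by blast
      then show "n + p \<in> decrement X 1 \<longleftrightarrow> n \<in> decrement X 1" by (simp add: decrement_def)
    qed
    show "L \<in> ?P" using per by blast
  qed
  then have "\<And>n. n \<ge> N \<Longrightarrow> n + p \<in> X \<longleftrightarrow> n \<in> X" using assms(2) by blast
  then show ?thesis by (rule eventually_periodic_imp_regular_nat_set[OF p])
qed

lemma regular_nat_set_finite: "finite L \<Longrightarrow> regular_nat_set L"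
  unfolding regular_nat_set_iff_arith_progs by (intro exI[of _ L] exI[of _ "{}"]) simp

lemma regular_nat_set_arith_prog: "r > 0 \<Longrightarrow> regular_nat_set (arith_prog q r)"
  unfolding regular_nat_set_iff_arith_progs
  by (intro exI[of _ "{}"] exI[of _ "{(q, r)}"]) simp

text \<open>Only \<open>t = 0\<close> is wanted for \<open>X\<close>, but the implication for all
  \<open>t\<close> is what survives decrements.\<close>

lemma generated_lattice_upward:
  assumes "\<And>t. a + t \<in> L \<Longrightarrow> b + t \<in> L" "X \<in> generated_lattice L" "a \<in> X"
  shows "b \<in> X"
proof -
  let ?P = "{X. \<forall>t. a + t \<in> X \<longrightarrow> b + t \<in> X}"
  have "generated_lattice L \<subseteq> ?P"
  proof (rule generated_lattice_least)
    show "set_lattice ?P" by (auto simp: set_lattice_def)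
    show "closed_under_decrement ?P"
      unfolding closed_under_decrement_def
    proof (intro ballI CollectI allI impI)
      fix X t assume "X \<in> ?P" "a + t \<in> decrement X 1"
      then show "b + t \<in> decrement X 1"
        by (simp add: decrement_def) (metis add_Suc_right)
    qed
    show "L \<in> ?P" using assms(1) by blast
  qed
  then have "a + 0 \<in> X \<longrightarrow> b + 0 \<in> X" using assms(2) by blast
  then show ?thesis using assms(3) by simp
qed

lemma generated_lattice_atMost_subset:
  assumes "X \<in> generated_lattice {..n::nat}"
  shows "X \<subseteq> {..n}"
proof -
  have "generated_lattice {..n} \<subseteq> Pow {..n}"
    by (rule generated_lattice_least)
      (auto simp: set_lattice_def closed_under_decrement_def decrement_def dest: subsetD)
  with assms show ?thesis by blast
qed

lemma generated_lattice_atLeast_superset: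
  assumes "X \<in> generated_lattice {n::nat..}"
  shows "{n..} \<subseteq> X"
proof -
  have "generated_lattice {n..} \<subseteq> {X. {n..} \<subseteq> X}"
    by (rule generated_lattice_least)
      (auto simp: set_lattice_def closed_under_decrement_def decrement_def dest: subsetD)
  with assms show ?thesis by blast
qed

section \<open>From closure on test sets to the arithmetic conditions\<close>

lemma cong_differencesI:
  fixes f :: "nat \<Rightarrow> nat"
  assumes "\<And>a b. a < b \<Longrightarrow> int (b - a) dvd int (f b) - int (f a)"
  shows "[int (f a) - int (f b) = 0] (mod (int a - int b))"
proof -
  have *: "int b - int a dvd int (f b) - int (f a)" if "a < b" for a b
    using assms[OF that] that by (simp add: of_nat_diff)
  have "int a - int b dvd int (f a) - int (f b)"
  proof (cases a b rule: linorder_cases)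
    case less
    from *[OF this] show ?thesis by (metis dvd_minus_iff minus_diff_eq minus_dvd_iff)
  qed (use * in auto)
  then show ?thesis by (simp add: cong_0_iff)
qed

lemma arith_conditions_if_closed_finite:
  fixes f :: "nat \<Rightarrow> nat"
  assumes "\<And>L. finite L \<Longrightarrow> closed_under_preimage f (generated_lattice L)"
  shows "mono f" "f a \<ge> a" "[int (f a) - int (f b) = 0] (mod (int a - int b))"
proof -
  have pre: "f -` L \<in> generated_lattice L" if "finite L" for L
    using assms[OF that] mem_generated_lattice by (auto simp: closed_under_preimage_def)
  show "mono f"
  proof (rule monoI)
    fix a b :: nat assume "a \<le> b"
    have "a \<in> f -` {..f b}"
      by (rule generated_lattice_upward[where a = b, OF _ pre]) (use \<open>a \<le> b\<close> in auto)
    then show "f a \<le> f b" by simp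
  qed
  show "f a \<ge> a"
    using generated_lattice_atMost_subset[OF pre[of "{..f a}"]] by auto
  show "[int (f a) - int (f b) = 0] (mod (int a - int b))"
  proof (rule cong_differencesI)
    fix a b :: nat assume "a < b"
    \<comment> \<open>A progression with difference \<open>b - a\<close> cut off at its last term
      \<open>f b\<close>: being finite, it allows steps of \<open>b - a\<close> downwards only, so
      membership passes from \<open>b\<close> to \<open>a\<close>.\<close>
    define L where "L = {x. x \<le> f b \<and> int (b - a) dvd int (f b) - int x}"
    have "finite L" by (rule finite_subset[of _ "{..f b}"]) (auto simp: L_def)
    have "a \<in> f -` L"
    proof (rule generated_lattice_upward[where a = b, OF _ pre[OF \<open>finite L\<close>]])
      fix t assume "b + t \<in> L"
      then have "a + t \<le> f b" "int (b - a) dvd int (f b) - int (b + t) + int (b - a)"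
        using \<open>a < b\<close> by (auto simp: L_def simp del: of_nat_add intro: dvd_add)
      moreover have "int (f b) - int (b + t) + int (b - a) = int (f b) - int (a + t)"
        using \<open>a < b\<close> by simp
      ultimately show "a + t \<in> L" unfolding L_def by (metis mem_Collect_eq)
    qed (simp add: L_def)
    then show "int (b - a) dvd int (f b) - int (f a)" by (simp add: L_def)
  qed
qed

lemma arith_conditions_if_closed_arith_prog:
  fixes f :: "nat \<Rightarrow> nat"
  assumes "\<And>q r. r > 0 \<Longrightarrow> closed_under_preimage f (generated_lattice (arith_prog q r))"
  shows "mono f" "f a \<ge> a" "[int (f a) - int (f b) = 0] (mod (int a - int b))"
proof -
  have pre: "f -` arith_prog q r \<in> generated_lattice (arith_prog q r)" if "r > 0" for q r
    using assms[OF that] mem_generated_lattice by (auto simp: closed_under_preimage_def)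
  have "arith_prog q 1 = {q..}" for q
    by (auto simp: arith_prog_def dest: le_Suc_ex)
  then have pre1: "f -` {q..} \<in> generated_lattice {q..}" for q
    using pre[of 1 q] by simp
  show "mono f"
  proof (rule monoI)
    fix a b :: nat assume "a \<le> b"
    have "b \<in> f -` {f a..}"
      by (rule generated_lattice_upward[where a = a, OF _ pre1]) (use \<open>a \<le> b\<close> in auto)
    then show "f a \<le> f b" by simp
  qed
  show "f a \<ge> a"
    using generated_lattice_atLeast_superset[OF pre1[of a]] by auto
  show "[int (f a) - int (f b) = 0] (mod (int a - int b))"
  proof (rule cong_differencesI)
    fix a b :: nat assume "a < b"
    \<comment> \<open>An infinite progression allows steps of \<open>b - a\<close> upwards, so it
      starts at \<open>f a\<close> and membership passes from \<open>a\<close> to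
      \<open>b\<close>.\<close>
    define L where "L = arith_prog (f a) (b - a)"
    have "b \<in> f -` L"
    proof (rule generated_lattice_upward[where a = a and L = L])
      show "f -` L \<in> generated_lattice L" using pre \<open>a < b\<close> by (simp add: L_def)
      show "a \<in> f -` L" by (auto simp: L_def arith_prog_def)
      fix t assume "a + t \<in> L"
      then obtain n where n: "a + t = f a + (b - a) * n" by (auto simp: L_def arith_prog_def)
      have "b + t = f a + (b - a) * Suc n" using n \<open>a < b\<close> by simp
      then show "b + t \<in> L" unfolding L_def arith_prog_def by blast
    qed
    then obtain n where "f b = f a + (b - a) * n" by (auto simp: L_def arith_prog_def)
    then show "int (b - a) dvd int (f b) - int (f a)" by simp
  qed
qed

theorem theorem5p1:
  fixes f :: "nat \<Rightarrow> nat"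
  shows
    "let
       cond_i = (\<forall>\<L>. set_lattice \<L> \<and> (\<forall>L\<in>\<L>. regular_nat_set L) \<and> closed_under_decrement \<L> \<longrightarrow>
                   closed_under_preimage f \<L>);
       cond_ii = (\<forall>L::nat set. finite L \<longrightarrow> closed_under_preimage f (generated_lattice L));
       cond_iii = (\<forall>q r::nat. r > 0 \<longrightarrow>
                   closed_under_preimage f (generated_lattice (arith_prog q r)));
       cond_iv = (mono f \<and> (\<forall>a. f a \<ge> a) \<and>
                   (\<forall>a b. [int (f a) - int (f b) = 0] (mod (int a - int b))))
     in (cond_i \<longleftrightarrow> cond_ii) \<and> (cond_ii \<longleftrightarrow> cond_iii) \<and> (cond_iii \<longleftrightarrow> cond_iv)"
proof -
  define cond_i where "cond_i \<longleftrightarrow> (\<forall>\<L>. set_lattice \<L> \<and> (\<forall>L\<in>\<L>. regular_nat_set L) \<and>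
    closed_under_decrement \<L> \<longrightarrow> closed_under_preimage f \<L>)"
  define cond_ii where
    "cond_ii \<longleftrightarrow> (\<forall>L::nat set. finite L \<longrightarrow> closed_under_preimage f (generated_lattice L))"
  define cond_iii where "cond_iii \<longleftrightarrow> (\<forall>q r::nat. r > 0 \<longrightarrow>
    closed_under_preimage f (generated_lattice (arith_prog q r)))"
  define cond_iv where "cond_iv \<longleftrightarrow> mono f \<and> (\<forall>a. f a \<ge> a) \<and>
    (\<forall>a b. [int (f a) - int (f b) = 0] (mod (int a - int b)))"
  have regular: "closed_under_preimage f (generated_lattice L)" if cond_i "regular_nat_set L" for L
    using that generated_lattice_regular[OF that(2)] set_lattice_generated_lattice
      closed_under_decrement_generated_lattice unfolding cond_i_def by blast
  \<comment> \<open>Conditions (ii) and (iii) are not compared directly: each follows from (i) and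
    implies (iv), which leads back to (i).\<close>
  have "cond_i \<Longrightarrow> cond_ii"
    unfolding cond_ii_def using regular regular_nat_set_finite by blast
  moreover have "cond_i \<Longrightarrow> cond_iii"
    unfolding cond_iii_def using regular regular_nat_set_arith_prog by blast
  moreover have "cond_ii \<Longrightarrow> cond_iv"
    unfolding cond_ii_def cond_iv_def
    by (intro conjI allI; rule arith_conditions_if_closed_finite; simp)
  moreover have "cond_iii \<Longrightarrow> cond_iv"
    unfolding cond_iii_def cond_iv_def
    by (intro conjI allI; rule arith_conditions_if_closed_arith_prog; simp)
  moreover have "cond_iv \<Longrightarrow> cond_i"
    unfolding cond_iv_def cond_i_def closed_under_preimage_def
    by (intro allI impI ballI; elim conjE; rule preimage_mem_lattice; simp)
  ultimately show ?thesis
    unfolding Let_def cond_i_def [symmetric] cond_ii_def [symmetric] cond_iii_def [symmetric]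
      cond_iv_def [symmetric] by blast
qed

end
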